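(* Let $\mathcal{A}$ and $\mathcal{B}$ be 2-torsion free associative rings (not assumed unital) such that each of them is either semiprime or satisfies Condition (P). Let $\mathcal{M}$ be a 2-torsion free faithful $(\mathcal{A},\mathcal{B})$-bimodule such that $\{m\in\mathcal{M} : \mathcal{A}m=\{0\}\}=\{0\}$ and $\{m\in\mathcal{M} : m\mathcal{B}=\{0\}\}=\{0\}$. Let $\mathfrak{T}=Tri(\mathcal{A},\mathcal{M},\mathcal{B})$ be the associated triangular ring, and let $\Phi:\mathfrak{T}\to\mathfrak{T}$ be a Jordan two-sided generalized derivation associated with a Jordan derivation $\Delta:\mathfrak{T}\to\mathfrak{T}$. Then $\Delta$ is a derivation and $\Phi$ is a two-sided generalized derivation associated with the derivation $\Delta$.
   Context: Rings are associative and need not have a unity; modules are not assumed unital. An $(\mathcal{A},\mathcal{B})$-bimodule $\mathcal{M}$ is faithful if it is faithful as a left $\mathcal{A}$-module ($a\mathcal{M}=\{0\}$ implies $a=0$) and as a right $\mathcal{B}$-module ($\mathcal{M}b=\{0\}$ implies $b=0$). The triangular ring $Tri(\mathcal{A},\mathcal{M},\mathcal{B})$ is the set of all matrices $\begin{bmatrix} a & m\\ 0 & b\end{bmatrix}$ with $a\in\mathcal{A}$, $m\in\mathcal{M}$, $b\in\mathcal{B}$, under the usual matrix operations. A ring or module $R$ is 2-torsion free if $2x=0$ implies $x=0$. A ring $\mathcal{R}$ is semiprime if $x\mathcal{R}x=\{0\}$ implies $x=0$. A ring $\mathcal{R}$ satisfies Condition (P) if, for $a\in\mathcal{R}$, $xax=0$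 for all $x\in\mathcal{R}$ implies $a=0$. An additive map $\Delta:\mathcal{R}\to\mathcal{R}$ is a Jordan derivation if $\Delta(x^2)=\Delta(x)x+x\Delta(x)$ for all $x\in\mathcal{R}$, and a derivation if $\Delta(xy)=\Delta(x)y+x\Delta(y)$ for all $x,y\in\mathcal{R}$. An additive map $\Phi:\mathcal{R}\to\mathcal{R}$ is a Jordan two-sided generalized derivation associated with a Jordan derivation $\Delta$ if $\Phi(x^2)=\Phi(x)x+x\Delta(x)=x\Phi(x)+\Delta(x)x$ for all $x\in\mathcal{R}$. An additive map $\Phi:\mathcal{R}\to\mathcal{R}$ is a two-sided generalized derivation associated with a derivation $\Delta$ if $\Phi(xy)=\Phi(x)y+x\Delta(y)=x\Phi(y)+\Delta(x)y$ for all $x,y\in\mathcal{R}$. *)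

theory Defs
  imports Complex_Main
begin

text \<open>
  The class \<open>ring\<close> has no unit element, so it captures associative rings as such.
  The triangular ring depends on the two module actions, which are not determined by the
  types of the entries; it can therefore not be an instance of \<open>ring\<close>. Its
  multiplication is an explicit function, and the notions of derivation below take the
  multiplication of the ring as their first argument.
\<close>

definition two_torsion_free :: "'r::ab_group_add itself \<Rightarrow> bool" where
  "two_torsion_free _ \<longleftrightarrow> (\<forall>x::'r. x + x = 0 \<longrightarrow> x = 0)"

definition semiprime_ring :: "'r::ring itself \<Rightarrow> bool" where
  "semiprime_ring _ \<longleftrightarrow> (\<forall>x::'r. (\<forall>r. x * r * x = 0) \<longrightarrow> x = 0)"

definition condition_P :: "'r::ring itself \<Rightarrow> bool" where
  "condition_P _ \<longleftrightarrow> (\<forall>a::'r. (\<forall>x. x * a * x = 0) \<longrightarrow> a = 0)"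

locale bimodule =
  fixes lact :: "'a::ring \<Rightarrow> 'm::ab_group_add \<Rightarrow> 'm" (infixr \<open>\<rhd>\<close> 75)
    and ract :: "'m \<Rightarrow> 'b::ring \<Rightarrow> 'm" (infixl \<open>\<lhd>\<close> 75)
  assumes lact_add_left: "(a + a') \<rhd> m = a \<rhd> m + a' \<rhd> m"
    and lact_add_right: "a \<rhd> (m + m') = a \<rhd> m + a \<rhd> m'"
    and lact_mult: "(a * a') \<rhd> m = a \<rhd> (a' \<rhd> m)"
    and ract_add_left: "(m + m') \<lhd> b = m \<lhd> b + m' \<lhd> b"
    and ract_add_right: "m \<lhd> (b + b') = m \<lhd> b + m \<lhd> b'"
    and ract_mult: "m \<lhd> (b * b') = (m \<lhd> b) \<lhd> b'"
    and lact_ract: "(a \<rhd> m) \<lhd> b = a \<rhd> (m \<lhd> b)"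

locale faithful_bimodule = bimodule +
  assumes left_faithful: "(\<And>m. a \<rhd> m = 0) \<Longrightarrow> a = 0"
    and right_faithful: "(\<And>m. m \<lhd> b = 0) \<Longrightarrow> b = 0"

text \<open>\<open>Tri a m b\<close> is the upper triangular matrix with diagonal \<open>a, b\<close> and corner \<open>m\<close>.\<close>

datatype ('a, 'm, 'b) tri = Tri (ul: 'a) (ur: 'm) (lr: 'b)

instantiation tri :: (ab_group_add, ab_group_add, ab_group_add) ab_group_add
begin

definition "0 = Tri 0 0 0"
definition "x + y = Tri (ul x + ul y) (ur x + ur y) (lr x + lr y)"
definition "x - y = Tri (ul x - ul y) (ur x - ur y) (lr x - lr y)"
definition "- x = Tri (- ul x) (- ur x) (- lr x)"

instance
  by standard
    (simp_all add: zero_tri_def plus_tri_def minus_tri_def uminus_tri_def algebra_simps)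

end

definition tri_mult ::
  "('a::ring \<Rightarrow> 'm::ab_group_add \<Rightarrow> 'm) \<Rightarrow> ('m \<Rightarrow> 'b::ring \<Rightarrow> 'm) \<Rightarrow>
   ('a, 'm, 'b) tri \<Rightarrow> ('a, 'm, 'b) tri \<Rightarrow> ('a, 'm, 'b) tri" where
  "tri_mult lact ract x y =
     Tri (ul x * ul y) (lact (ul x) (ur y) + ract (ur x) (lr y)) (lr x * lr y)"

lemma (in bimodule) ring_tri:
  "class.ring (+) 0 (-) uminus (tri_mult (\<rhd>) (\<lhd>))"
  by standard
    (simp_all add: tri_mult_def plus_tri_def algebra_simps lact_add_left lact_add_right
      lact_mult ract_add_left ract_add_right ract_mult lact_ract)

definition jordan_derivation ::
  "('r \<Rightarrow> 'r \<Rightarrow> 'r) \<Rightarrow> ('r::ab_group_add \<Rightarrow> 'r) \<Rightarrow> bool" where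
  "jordan_derivation mul \<Delta> \<longleftrightarrow> additive \<Delta> \<and>
     (\<forall>x. \<Delta> (mul x x) = mul (\<Delta> x) x + mul x (\<Delta> x))"

definition derivation ::
  "('r \<Rightarrow> 'r \<Rightarrow> 'r) \<Rightarrow> ('r::ab_group_add \<Rightarrow> 'r) \<Rightarrow> bool" where
  "derivation mul \<Delta> \<longleftrightarrow> additive \<Delta> \<and>
     (\<forall>x y. \<Delta> (mul x y) = mul (\<Delta> x) y + mul x (\<Delta> y))"

definition jordan_two_sided_generalized_derivation ::
  "('r \<Rightarrow> 'r \<Rightarrow> 'r) \<Rightarrow> ('r::ab_group_add \<Rightarrow> 'r) \<Rightarrow> ('r \<Rightarrow> 'r) \<Rightarrow> bool" where
  "jordan_two_sided_generalized_derivation mul \<Delta> \<Phi> \<longleftrightarrow>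
     jordan_derivation mul \<Delta> \<and> additive \<Phi> \<and>
     (\<forall>x. \<Phi> (mul x x) = mul (\<Phi> x) x + mul x (\<Delta> x) \<and>
          \<Phi> (mul x x) = mul x (\<Phi> x) + mul (\<Delta> x) x)"

definition two_sided_generalized_derivation ::
  "('r \<Rightarrow> 'r \<Rightarrow> 'r) \<Rightarrow> ('r::ab_group_add \<Rightarrow> 'r) \<Rightarrow> ('r \<Rightarrow> 'r) \<Rightarrow> bool" where
  "two_sided_generalized_derivation mul \<Delta> \<Phi> \<longleftrightarrow>
     derivation mul \<Delta> \<and> additive \<Phi> \<and>
     (\<forall>x y. \<Phi> (mul x y) = mul (\<Phi> x) y + mul x (\<Delta> y) \<and>
            \<Phi> (mul x y) = mul x (\<Phi> y) + mul (\<Delta> x) y)"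

end

theory Submission
  imports Defs
begin

text \<open>
  The two maps can be treated one after the other, because \<open>\<Psi> = \<Phi> - \<Delta>\<close> satisfies
  \<open>\<Psi> (x\<^sup>2) = \<Psi> x x = x \<Psi> x\<close>, an identity from which \<open>\<Delta>\<close> has disappeared. So it is enough to
  show that a Jordan derivation \<open>\<Delta>\<close> is a derivation and that a Jordan centralizer \<open>\<Psi>\<close> is a
  centralizer, that is \<open>\<Psi> (x y) = \<Psi> x y = x \<Psi> y\<close>.

  Both proofs polarize the identity on squares and insert elements \<open>a\<close>, \<open>m\<close>, \<open>b\<close> supported in a
  single position of the matrix. For such elements the Jordan product \<open>x y + y x\<close> is often an
  ordinary product, as in \<open>a m + m a = a m\<close>, or zero, as in \<open>a b + b a = 0\<close>. For this reason the
  Jordan identity controls the associative products.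

  The first point is that the corner \<open>M\<close> is invariant. If \<open>p m\<close> is the \<open>A\<close>-component of \<open>\<Delta> m\<close>, then
  \<open>p (a m) = a p m + p m a\<close> and \<open>p (m b) = 0\<close>, and comparing \<open>a m\<close> with \<open>a' m' b\<close> shows that
  \<open>p (a m)\<close> annihilates \<open>A\<close>. Hence \<open>p (a m) = 0\<close>, and \<open>p m\<close> anticommutes with all of \<open>A\<close>.
  A 2-torsion free ring that is semiprime or satisfies Condition (P) has no such element
  other than \<open>0\<close>. The same fact removes the \<open>B\<close>-component of \<open>\<Delta> a\<close> and the \<open>A\<close>-component of
  \<open>\<Delta> b\<close>, since \<open>a b + b a = 0\<close>.

  In the resulting block form, \<open>\<Delta>\<close> obeys the Leibniz rule on the products \<open>a m\<close> and \<open>m b\<close>.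
  Expanding \<open>\<Delta> ((a a') m) = \<Delta> (a (a' m))\<close> and using faithfulness transfers the rule to \<open>a a'\<close>, and
  likewise to \<open>b b'\<close>. The \<open>M\<close>-components \<open>\<mu> a\<close> and \<open>\<nu> b\<close> of \<open>\<Delta> a\<close> and \<open>\<Delta> b\<close> are tied by
  \<open>\<mu> a b + a \<nu> b = 0\<close>, so that \<open>\<mu> (a a') b = - a a' \<nu> b = a \<mu> a' b\<close>; here \<open>b\<close> can be cancelled.
  The centralizer \<open>\<Psi>\<close> is handled by the same scheme; the \<open>M\<close>-components of \<open>\<Psi> a\<close> and \<open>\<Psi> b\<close> vanish.
\<close>

section \<open>Elements that annihilate or anticommute with a ring\<close>

lemma right_annihilator_eq_zero:
  fixes x :: "'r::ring"
  assumes "semiprime_ring TYPE('r) \<or> condition_P TYPE('r)"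
    and "\<And>a. x * a = 0"
  shows "x = 0"
  using assms unfolding semiprime_ring_def condition_P_def
  by (metis mult.assoc mult_zero_right)

lemma left_annihilator_eq_zero:
  fixes x :: "'r::ring"
  assumes "semiprime_ring TYPE('r) \<or> condition_P TYPE('r)"
    and "\<And>a. a * x = 0"
  shows "x = 0"
  using assms unfolding semiprime_ring_def condition_P_def
  by (metis mult_zero_left)

text \<open>
  An element \<open>x\<close> that anticommutes with everything commutes with all squares \<open>a\<^sup>2\<close>, so it
  annihilates them, and then \<open>a x a = - x a\<^sup>2 = 0\<close>, which is the premise of Condition (P). It also
  anticommutes with itself, so \<open>x\<^sup>2 = 0\<close> and \<open>x a x = - x\<^sup>2 a = 0\<close>, which is the premise
  of semiprimeness.
\<close>

lemma anticommuting_eq_zero: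
  fixes x :: "'r::ring"
  assumes tf: "two_torsion_free TYPE('r)"
    and cond: "semiprime_ring TYPE('r) \<or> condition_P TYPE('r)"
    and anti: "\<And>a. a * x + x * a = 0"
  shows "x = 0"
proof -
  have half: "y = 0" if "y + y = 0" for y :: 'r
    using tf that unfolding two_torsion_free_def by blast
  have swap: "a * x = - (x * a)" for a
    using anti[of a] by (simp add: eq_neg_iff_add_eq_0)
  have "x * x = 0"
    using anti[of x] by (rule half)
  then have "x * a * x = 0" for a
    by (metis mult.assoc swap minus_zero mult_minus_right mult_zero_left)
  moreover have "a * x * a = 0" for a
  proof -
    have "(a * a) * x = x * (a * a)"
      by (metis mult.assoc swap minus_minus mult_minus_left mult_minus_right)
    then have "x * (a * a) = 0"
      using anti[of "a * a"] by (metis half)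
    then show ?thesis
      by (simp add: swap mult.assoc)
  qed
  ultimately show ?thesis
    using cond unfolding semiprime_ring_def condition_P_def by blast
qed

section \<open>Triangular rings\<close>

context bimodule
begin

abbreviation mul :: "('a, 'm, 'b) tri \<Rightarrow> ('a, 'm, 'b) tri \<Rightarrow> ('a, 'm, 'b) tri"
    (infixl \<open>\<odot>\<close> 70)
  where "x \<odot> y \<equiv> tri_mult (\<rhd>) (\<lhd>) x y"

lemma lact_zero [simp]: "0 \<rhd> m = 0" "a \<rhd> 0 = 0"
  using lact_add_left[of 0 0 m] lact_add_right[of a 0 0] by simp_all

lemma ract_zero [simp]: "m \<lhd> 0 = 0" "0 \<lhd> b = 0"
  using ract_add_right[of m 0 0] ract_add_left[of 0 0 b] by simp_all

lemma lact_minus: "a \<rhd> (- m) = - (a \<rhd> m)" "(- a) \<rhd> m = - (a \<rhd> m)"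
  using lact_add_right[of a "- m" m] lact_add_left[of "- a" a m]
  by (simp_all add: eq_neg_iff_add_eq_0)

lemma ract_minus: "(- m) \<lhd> b = - (m \<lhd> b)" "m \<lhd> (- b) = - (m \<lhd> b)"
  using ract_add_left[of "- m" m b] ract_add_right[of m "- b" b]
  by (simp_all add: eq_neg_iff_add_eq_0)

lemma mul_Tri [simp]:
  "Tri a m b \<odot> Tri a' m' b' = Tri (a * a') (a \<rhd> m' + m \<lhd> b') (b * b')"
  by (simp add: tri_mult_def)

lemma add_Tri [simp]: "Tri a m b + Tri a' m' b' = Tri (a + a') (m + m') (b + b')"
  by (simp add: plus_tri_def)

lemma Tri_eq_zero [simp]: "Tri a m b = 0 \<longleftrightarrow> a = 0 \<and> m = 0 \<and> b = 0"
  by (auto simp: zero_tri_def)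

lemma mul_add_left: "(x + y) \<odot> z = x \<odot> z + y \<odot> z"
  by (cases x; cases y; cases z) (simp add: algebra_simps lact_add_left ract_add_left)

lemma mul_add_right: "z \<odot> (x + y) = z \<odot> x + z \<odot> y"
  by (cases x; cases y; cases z) (simp add: algebra_simps lact_add_right ract_add_right)

lemma mul_zero [simp]: "0 \<odot> x = 0" "x \<odot> 0 = 0"
  by (cases x; simp add: tri_mult_def zero_tri_def)+

lemma mul_diff_left: "(x - y) \<odot> z = x \<odot> z - y \<odot> z"
  using mul_add_left[of "x - y" y z] by (simp add: eq_diff_eq)

lemma mul_diff_right: "z \<odot> (x - y) = z \<odot> x - z \<odot> y"
  using mul_add_right[of z "x - y" y] by (simp add: eq_diff_eq)

text \<open>
  The linearization of an identity on squares. Three maps are allowed so that Jordan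
  derivations (\<open>f = g = h\<close>) and the two halves of a Jordan centralizer (\<open>h = 0\<close> or \<open>g = 0\<close>)
  are all instances.
\<close>

lemma polarize:
  assumes "additive f" "additive g" "additive h"
    and square: "\<And>x. f (x \<odot> x) = g x \<odot> x + x \<odot> h x"
  shows "f (x \<odot> y + y \<odot> x) = g x \<odot> y + g y \<odot> x + x \<odot> h y + y \<odot> h x"
proof -
  have "f (x \<odot> x) + f (y \<odot> y) + f (x \<odot> y + y \<odot> x) = f ((x + y) \<odot> (x + y))"
    by (simp add: mul_add_left mul_add_right additive.add[OF assms(1)] algebra_simps)
  also have "\<dots> = g (x + y) \<odot> (x + y) + (x + y) \<odot> h (x + y)"
    by (rule square)
  also have "\<dots> = f (x \<odot> x) + f (y \<odot> y) + (g x \<odot> y + g y \<odot> x + x \<odot> h y + y \<odot> h x)"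
    by (simp add: square mul_add_left mul_add_right additive.add[OF assms(2)]
        additive.add[OF assms(3)] algebra_simps)
  finally show ?thesis by simp
qed

end

locale admissible_bimodule = faithful_bimodule lact ract
  for lact :: "'a::ring \<Rightarrow> 'm::ab_group_add \<Rightarrow> 'm" (infixr \<open>\<rhd>\<close> 75)
    and ract :: "'m \<Rightarrow> 'b::ring \<Rightarrow> 'm" (infixl \<open>\<lhd>\<close> 75) +
  assumes left_nondegenerate: "(\<And>a. a \<rhd> m = 0) \<Longrightarrow> m = 0"
    and right_nondegenerate: "(\<And>b. m \<lhd> b = 0) \<Longrightarrow> m = 0"
    and A_torsion: "two_torsion_free TYPE('a)"
    and B_torsion: "two_torsion_free TYPE('b)"
    and A_cond: "semiprime_ring TYPE('a) \<or> condition_P TYPE('a)"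
    and B_cond: "semiprime_ring TYPE('b) \<or> condition_P TYPE('b)"
begin

lemma left_faithful_eq: "(\<And>m. a \<rhd> m = a' \<rhd> m) \<Longrightarrow> a = a'"
  using left_faithful[of "a - a'"] lact_add_left[of a "- a'"] by (simp add: lact_minus)

lemma right_faithful_eq: "(\<And>m. m \<lhd> b = m \<lhd> b') \<Longrightarrow> b = b'"
  using right_faithful[of "b - b'"] ract_add_right[of _ b "- b'"] by (simp add: ract_minus)

lemma left_cancel: "(\<And>a. a \<rhd> m = a \<rhd> m') \<Longrightarrow> m = m'"
  using left_nondegenerate[of "m - m'"] lact_add_right[of _ m "- m'"] by (simp add: lact_minus)

lemma right_cancel: "(\<And>b. m \<lhd> b = m' \<lhd> b) \<Longrightarrow> m = m'"
  using right_nondegenerate[of "m - m'"] ract_add_left[of m "- m'"] by (simp add: ract_minus)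

section \<open>Jordan derivations\<close>

text \<open>
  Polarizing at two corner elements gives \<open>p m m' + p m' m + m r m' + m' r m = 0\<close>, where \<open>p\<close> and
  \<open>r\<close> are the diagonal components of \<open>\<Delta>\<close> on the corner. The map \<open>p\<close> vanishes on \<open>M B\<close> and \<open>r\<close>
  vanishes on \<open>A M\<close>, so suitable products isolate a single term of this sum.
\<close>

lemma jordan_derivation_corner:
  assumes "jordan_derivation (\<odot>) \<Delta>"
  obtains q where "\<And>m. \<Delta> (Tri 0 m 0) = Tri 0 (q m) 0"
proof -
  have add: "additive \<Delta>"
    and pol: "\<And>x y. \<Delta> (x \<odot> y + y \<odot> x) = \<Delta> x \<odot> y + \<Delta> y \<odot> x + x \<odot> \<Delta> y + y \<odot> \<Delta> x"
    using assms polarize[of \<Delta> \<Delta> \<Delta>] by (auto simp: jordan_derivation_def)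
  define p where "p m = ul (\<Delta> (Tri 0 m 0))" for m
  define q where "q m = ur (\<Delta> (Tri 0 m 0))" for m
  define r where "r m = lr (\<Delta> (Tri 0 m 0))" for m
  have D: "\<Delta> (Tri 0 m 0) = Tri (p m) (q m) (r m)" for m
    by (simp add: p_def q_def r_def)
  have am: "p (a \<rhd> m) = a * p m + p m * a" "r (a \<rhd> m) = 0" for a m
    using pol[of "Tri a 0 0" "Tri 0 m 0"]
    by (cases "\<Delta> (Tri a 0 0)"; simp add: D add.commute)+
  have mb: "p (m \<lhd> b) = 0" "r (m \<lhd> b) = b * r m + r m * b" for m b
    using pol[of "Tri 0 0 b" "Tri 0 m 0"]
    by (cases "\<Delta> (Tri 0 0 b)"; simp add: D add.commute)+
  have mm: "p m \<rhd> m' + p m' \<rhd> m + m \<lhd> r m' + m' \<lhd> r m = 0" for m m'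
    using pol[of "Tri 0 m 0" "Tri 0 m' 0"] additive.zero[OF add]
    by (simp add: D zero_tri_def algebra_simps)
  \<comment> \<open>With \<open>a m\<close> and \<open>a' m' b\<close> in the polarized identity, only the first of its four terms
    survives, because \<open>a' m' b\<close> lies in both \<open>A M\<close> and \<open>M B\<close>.\<close>
  have p_am: "p (a \<rhd> m) = 0" for a m
  proof -
    have "(p (a \<rhd> m) * a') \<rhd> (m' \<lhd> b) = 0" for a' m' b
      using mm[of "a \<rhd> m" "a' \<rhd> (m' \<lhd> b)"] am(2)[of a m] am(2)[of a' "m' \<lhd> b"] mb(1)[of "a' \<rhd> m'"]
      by (simp add: lact_ract lact_mult)
    then have "p (a \<rhd> m) * a' = 0" for a'
      by (metis left_faithful right_nondegenerate lact_ract)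
    then show ?thesis
      by (rule right_annihilator_eq_zero[OF A_cond])
  qed
  have r_mb: "r (m \<lhd> b) = 0" for m b
  proof -
    have "(a \<rhd> m') \<lhd> (b' * r (m \<lhd> b)) = 0" for a m' b'
      using mm[of "a \<rhd> (m' \<lhd> b')" "m \<lhd> b"] mb(1)[of m b] mb(1)[of "a \<rhd> m'" b'] am(2)[of a "m' \<lhd> b'"]
      by (simp add: lact_ract ract_mult)
    then have "b' * r (m \<lhd> b) = 0" for b'
      by (metis right_faithful left_nondegenerate lact_ract)
    then show ?thesis
      by (rule left_annihilator_eq_zero[OF B_cond])
  qed
  have "p m = 0" for m
    using anticommuting_eq_zero[OF A_torsion A_cond] am(1) p_am by metis
  moreover have "r m = 0" for m
    using anticommuting_eq_zero[OF B_torsion B_cond] mb(2) r_mb by metis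
  ultimately show ?thesis
    using that D by simp
qed

text \<open>
  The Jordan product of \<open>a\<close> and \<open>b\<close> is \<open>0\<close>, so the polarized identity is a vanishing matrix. Its
  diagonal entries say that the unwanted components of \<open>\<Delta> b\<close> and \<open>\<Delta> a\<close> anticommute with \<open>A\<close> and
  \<open>B\<close>, and its corner is the relation between \<open>\<mu>\<close> and \<open>\<nu>\<close>.
\<close>

lemma jordan_derivation_diagonal:
  assumes "jordan_derivation (\<odot>) \<Delta>"
  obtains \<alpha> \<mu> \<nu> \<beta>
  where "\<And>a. \<Delta> (Tri a 0 0) = Tri (\<alpha> a) (\<mu> a) 0"
    and "\<And>b. \<Delta> (Tri 0 0 b) = Tri 0 (\<nu> b) (\<beta> b)"
    and "\<And>a b. \<mu> a \<lhd> b + a \<rhd> \<nu> b = 0"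
proof -
  have add: "additive \<Delta>"
    and pol: "\<And>x y. \<Delta> (x \<odot> y + y \<odot> x) = \<Delta> x \<odot> y + \<Delta> y \<odot> x + x \<odot> \<Delta> y + y \<odot> \<Delta> x"
    using assms polarize[of \<Delta> \<Delta> \<Delta>] by (auto simp: jordan_derivation_def)
  define DA where "DA a = \<Delta> (Tri a 0 0)" for a
  define DB where "DB b = \<Delta> (Tri 0 0 b)" for b
  have orth: "DA a \<odot> Tri 0 0 b + DB b \<odot> Tri a 0 0 + Tri a 0 0 \<odot> DB b + Tri 0 0 b \<odot> DA a = 0" for a b
    using pol[of "Tri a 0 0" "Tri 0 0 b"] additive.zero[OF add]
    by (simp add: DA_def DB_def zero_tri_def)
  have ab: "a * ul (DB b) + ul (DB b) * a = 0" "b * lr (DA a) + lr (DA a) * b = 0"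
      "ur (DA a) \<lhd> b + a \<rhd> ur (DB b) = 0" for a b
    using orth[of a b] by (cases "DA a"; cases "DB b"; simp add: add.commute)+
  have "ul (DB b) = 0" for b
    using anticommuting_eq_zero[OF A_torsion A_cond] ab(1) by metis
  moreover have "lr (DA a) = 0" for a
    using anticommuting_eq_zero[OF B_torsion B_cond] ab(2) by metis
  ultimately have "\<Delta> (Tri a 0 0) = Tri (ul (DA a)) (ur (DA a)) 0"
      "\<Delta> (Tri 0 0 b) = Tri 0 (ur (DB b)) (lr (DB b))" for a b
    by (metis DA_def DB_def tri.collapse)+
  then show ?thesis
    using ab(3) by (rule that)
qed

lemma jordan_derivation_imp_derivation:
  assumes "jordan_derivation (\<odot>) \<Delta>"
  shows "derivation (\<odot>) \<Delta>"
proof -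
  have add: "additive \<Delta>"
    and pol: "\<And>x y. \<Delta> (x \<odot> y + y \<odot> x) = \<Delta> x \<odot> y + \<Delta> y \<odot> x + x \<odot> \<Delta> y + y \<odot> \<Delta> x"
    using assms polarize[of \<Delta> \<Delta> \<Delta>] by (auto simp: jordan_derivation_def)
  note D_add = additive.add[OF add]
  obtain q where q: "\<And>m. \<Delta> (Tri 0 m 0) = Tri 0 (q m) 0"
    using jordan_derivation_corner[OF assms] by blast
  obtain \<alpha> \<mu> \<nu> \<beta>
    where \<alpha>\<mu>: "\<And>a. \<Delta> (Tri a 0 0) = Tri (\<alpha> a) (\<mu> a) 0"
      and \<nu>\<beta>: "\<And>b. \<Delta> (Tri 0 0 b) = Tri 0 (\<nu> b) (\<beta> b)"
      and \<mu>\<nu>: "\<And>a b. \<mu> a \<lhd> b + a \<rhd> \<nu> b = 0"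
    using jordan_derivation_diagonal[OF assms] by blast
  have D: "\<Delta> (Tri a m b) = Tri (\<alpha> a) (\<mu> a + q m + \<nu> b) (\<beta> b)" for a m b
    using D_add[of "Tri a 0 0" "Tri 0 m 0 + Tri 0 0 b"] D_add[of "Tri 0 m 0" "Tri 0 0 b"]
    by (simp add: q \<alpha>\<mu> \<nu>\<beta> algebra_simps)
  have q_add: "q (m + m') = q m + q m'" for m m'
    using D_add[of "Tri 0 m 0" "Tri 0 m' 0"] by (simp add: q)
  have q_am: "q (a \<rhd> m) = \<alpha> a \<rhd> m + a \<rhd> q m" for a m
    using pol[of "Tri a 0 0" "Tri 0 m 0"] by (simp add: q \<alpha>\<mu>)
  have q_mb: "q (m \<lhd> b) = q m \<lhd> b + m \<lhd> \<beta> b" for m b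
    using pol[of "Tri 0 m 0" "Tri 0 0 b"] by (simp add: q \<nu>\<beta>)
  \<comment> \<open>Both sides act on \<open>m\<close> in the same way: expand \<open>q (a a' m)\<close> for the product \<open>a a'\<close> at once,
    and for \<open>a\<close> and \<open>a'\<close> in succession.\<close>
  have \<alpha>_mult: "\<alpha> (a * a') = \<alpha> a * a' + a * \<alpha> a'" for a a'
  proof (rule left_faithful_eq)
    fix m
    have "\<alpha> (a * a') \<rhd> m + a \<rhd> a' \<rhd> q m = q (a \<rhd> a' \<rhd> m)"
      using q_am[of "a * a'" m] by (simp add: lact_mult)
    also have "\<dots> = (\<alpha> a * a' + a * \<alpha> a') \<rhd> m + a \<rhd> a' \<rhd> q m"
      by (simp add: q_am lact_mult lact_add_left lact_add_right add.assoc)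
    finally show "\<alpha> (a * a') \<rhd> m = (\<alpha> a * a' + a * \<alpha> a') \<rhd> m" by simp
  qed
  have \<beta>_mult: "\<beta> (b * b') = \<beta> b * b' + b * \<beta> b'" for b b'
  proof (rule right_faithful_eq)
    fix m
    have "q m \<lhd> b \<lhd> b' + m \<lhd> \<beta> (b * b') = q (m \<lhd> b \<lhd> b')"
      using q_mb[of m "b * b'"] by (simp add: ract_mult)
    also have "\<dots> = q m \<lhd> b \<lhd> b' + m \<lhd> (\<beta> b * b' + b * \<beta> b')"
      by (simp add: q_mb ract_mult ract_add_left ract_add_right add.assoc)
    finally show "m \<lhd> \<beta> (b * b') = m \<lhd> (\<beta> b * b' + b * \<beta> b')" by simp
  qed
  have \<mu>_eq: "\<mu> a \<lhd> b = - (a \<rhd> \<nu> b)" for a b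
    using \<mu>\<nu> by (simp add: eq_neg_iff_add_eq_0)
  then have \<nu>_eq: "a \<rhd> \<nu> b = - (\<mu> a \<lhd> b)" for a b
    by simp
  have \<mu>_mult: "\<mu> (a * a') = a \<rhd> \<mu> a'" for a a'
    by (rule right_cancel) (simp add: \<mu>_eq lact_ract lact_mult lact_minus)
  have \<nu>_mult: "\<nu> (b * b') = \<nu> b \<lhd> b'" for b b'
    by (rule left_cancel)
      (simp add: \<nu>_eq lact_ract[symmetric] ract_mult ract_minus)
  have "\<Delta> (x \<odot> y) = \<Delta> x \<odot> y + x \<odot> \<Delta> y" for x y
    by (cases x; cases y)
      (simp add: D \<alpha>_mult \<beta>_mult \<mu>_mult \<nu>_mult q_add q_am q_mb \<mu>_eq
        lact_add_right ract_add_left algebra_simps)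
  then show ?thesis
    using add by (simp add: derivation_def)
qed

section \<open>Jordan centralizers\<close>

text \<open>
  Let \<open>p m\<close> be the \<open>A\<close>-component of \<open>\<Psi> m\<close>. The relations \<open>p (m b) = 0\<close> and \<open>p m m' = - p m' m\<close>
  give \<open>p m m' b = 0\<close>, and cancelling \<open>b\<close> and then \<open>m'\<close> yields \<open>p m = 0\<close>. Since \<open>a b + b a = 0\<close>,
  the components of \<open>\<Psi> a\<close> outside \<open>A\<close> annihilate \<open>B\<close>, those of \<open>\<Psi> b\<close> outside \<open>B\<close>
  annihilate \<open>A\<close>, and all of them vanish.
  In the block form \<open>(\<alpha>, q, \<beta>)\<close>,
  the map \<open>q\<close> of the corner satisfies \<open>\<alpha> a m = q (a m) = a q m\<close>, so it determines \<open>\<alpha>\<close>, and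
  likewise \<open>\<beta>\<close>.
\<close>

lemma jordan_centralizer_block_form:
  assumes add: "additive \<Psi>"
    and left: "\<And>x. \<Psi> (x \<odot> x) = \<Psi> x \<odot> x"
    and right: "\<And>x. \<Psi> (x \<odot> x) = x \<odot> \<Psi> x"
  obtains \<alpha> q \<beta>
  where "\<And>a m b. \<Psi> (Tri a m b) = Tri (\<alpha> a) (q m) (\<beta> b)"
    and "\<And>a m. q (a \<rhd> m) = \<alpha> a \<rhd> m" and "\<And>a m. q (a \<rhd> m) = a \<rhd> q m"
    and "\<And>m b. q (m \<lhd> b) = m \<lhd> \<beta> b" and "\<And>m b. q (m \<lhd> b) = q m \<lhd> b"
proof -
  have zero_add: "additive (\<lambda>_. 0 :: ('a, 'm, 'b) tri)"
    by (simp add: additive_def)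
  have L: "\<Psi> (x \<odot> y + y \<odot> x) = \<Psi> x \<odot> y + \<Psi> y \<odot> x" for x y
    using polarize[OF add add zero_add] left by simp
  have R: "\<Psi> (x \<odot> y + y \<odot> x) = x \<odot> \<Psi> y + y \<odot> \<Psi> x" for x y
    using polarize[OF add zero_add add] right by simp
  have zero: "\<Psi> (Tri 0 0 0) = Tri 0 0 0"
    using additive.zero[OF add] by (simp add: zero_tri_def)
  define PA where "PA a = \<Psi> (Tri a 0 0)" for a
  define PM where "PM m = \<Psi> (Tri 0 m 0)" for m
  define PB where "PB b = \<Psi> (Tri 0 0 b)" for b
  have ab: "ul (PB b) * a = 0" "ur (PA a) \<lhd> b = 0" "lr (PA a) * b = 0" "a \<rhd> ur (PB b) = 0"
    for a b
    using L[of "Tri a 0 0" "Tri 0 0 b"] R[of "Tri a 0 0" "Tri 0 0 b"]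
    by (cases "PA a"; cases "PB b"; simp add: PA_def PB_def zero)+
  have "ul (PB b) = 0" "ur (PB b) = 0" for b
    using right_annihilator_eq_zero[OF A_cond] left_nondegenerate ab by metis+
  then have B: "PB b = Tri 0 0 (lr (PB b))" for b
    by (metis tri.collapse)
  have "ur (PA a) = 0" "lr (PA a) = 0" for a
    using right_annihilator_eq_zero[OF B_cond] right_nondegenerate ab by metis+
  then have A: "PA a = Tri (ul (PA a)) 0 0" for a
    by (metis tri.collapse)
  have am: "PM (a \<rhd> m) = PA a \<odot> Tri 0 m 0 + PM m \<odot> Tri a 0 0"
      "PM (a \<rhd> m) = Tri a 0 0 \<odot> PM m + Tri 0 m 0 \<odot> PA a" for a m
    using L[of "Tri a 0 0" "Tri 0 m 0"] R[of "Tri a 0 0" "Tri 0 m 0"]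
    by (simp_all add: PA_def PM_def)
  have mb: "PM (m \<lhd> b) = PM m \<odot> Tri 0 0 b + PB b \<odot> Tri 0 m 0"
      "PM (m \<lhd> b) = Tri 0 m 0 \<odot> PB b + Tri 0 0 b \<odot> PM m" for m b
    using L[of "Tri 0 m 0" "Tri 0 0 b"] R[of "Tri 0 m 0" "Tri 0 0 b"]
    by (simp_all add: PB_def PM_def)
  have mm: "ul (PM m) \<rhd> m' + ul (PM m') \<rhd> m = 0" "m \<lhd> lr (PM m') + m' \<lhd> lr (PM m) = 0"
    for m m'
    using L[of "Tri 0 m 0" "Tri 0 m' 0"] R[of "Tri 0 m 0" "Tri 0 m' 0"]
    by (cases "PM m"; cases "PM m'"; simp add: PM_def zero)+
  have mb_ul: "ul (PM (m \<lhd> b)) = 0" for m b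
    by (subst mb(1), subst B) (cases "PM m"; simp)
  have am_lr: "lr (PM (a \<rhd> m)) = 0" for a m
    by (subst am(1), subst A) (cases "PM m"; simp)
  have "ul (PM m) = 0" for m
  proof (rule left_faithful, rule right_nondegenerate)
    show "(ul (PM m) \<rhd> m') \<lhd> b = 0" for m' b
      using mm(1)[of m "m' \<lhd> b"] by (simp add: mb_ul lact_ract)
  qed
  moreover have "lr (PM m) = 0" for m
  proof (rule right_faithful, rule left_nondegenerate)
    show "a \<rhd> (m' \<lhd> lr (PM m)) = 0" for m' a
      using mm(2)[of m "a \<rhd> m'"] by (simp add: am_lr lact_ract)
  qed
  ultimately have M: "PM m = Tri 0 (ur (PM m)) 0" for m
    by (metis tri.collapse)
  show ?thesis
  proof (rule that)
    show "\<Psi> (Tri a m b) = Tri (ul (PA a)) (ur (PM m)) (lr (PB b))" for a m b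
    proof -
      have "Tri a m b = Tri a 0 0 + Tri 0 m 0 + Tri 0 0 b" by simp
      then have "\<Psi> (Tri a m b) = PA a + PM m + PB b"
        by (simp only: additive.add[OF add] PA_def PM_def PB_def)
      then show ?thesis
        using A[of a] M[of m] B[of b] by (metis add_Tri add_0 add_0_right)
    qed
  next
    fix a m
    show "ur (PM (a \<rhd> m)) = ul (PA a) \<rhd> m"
      using am(1)[of a m] A[of a] M[of m] by (cases "PA a"; cases "PM m"; simp)
    show "ur (PM (a \<rhd> m)) = a \<rhd> ur (PM m)"
      using am(2)[of a m] A[of a] M[of m] by (cases "PA a"; cases "PM m"; simp)
  next
    fix m b
    show "ur (PM (m \<lhd> b)) = m \<lhd> lr (PB b)"
      using mb(2)[of m b] B[of b] M[of m] by (cases "PB b"; cases "PM m"; simp)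
    show "ur (PM (m \<lhd> b)) = ur (PM m) \<lhd> b"
      using mb(1)[of m b] B[of b] M[of m] by (cases "PB b"; cases "PM m"; simp)
  qed
qed

lemma jordan_centralizer_imp_centralizer:
  assumes add: "additive \<Psi>"
    and "\<And>x. \<Psi> (x \<odot> x) = \<Psi> x \<odot> x" and "\<And>x. \<Psi> (x \<odot> x) = x \<odot> \<Psi> x"
  shows "\<Psi> (x \<odot> y) = \<Psi> x \<odot> y" and "\<Psi> (x \<odot> y) = x \<odot> \<Psi> y"
proof -
  obtain \<alpha> q \<beta>
    where P: "\<And>a m b. \<Psi> (Tri a m b) = Tri (\<alpha> a) (q m) (\<beta> b)"
      and q_am: "\<And>a m. q (a \<rhd> m) = \<alpha> a \<rhd> m" "\<And>a m. q (a \<rhd> m) = a \<rhd> q m"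
      and q_mb: "\<And>m b. q (m \<lhd> b) = m \<lhd> \<beta> b" "\<And>m b. q (m \<lhd> b) = q m \<lhd> b"
    using jordan_centralizer_block_form[OF assms] by blast
  have q_add: "q (m + m') = q m + q m'" for m m'
    using additive.add[OF add, of "Tri 0 m 0" "Tri 0 m' 0"] by (simp add: P)
  have \<alpha>: "\<alpha> (a * a') = \<alpha> a * a'" "\<alpha> (a * a') = a * \<alpha> a'" for a a'
    by (rule left_faithful_eq, metis lact_mult q_am)+
  have \<beta>: "\<beta> (b * b') = \<beta> b * b'" "\<beta> (b * b') = b * \<beta> b'" for b b'
    by (rule right_faithful_eq, metis ract_mult q_mb)+
  obtain a m b a' m' b' where xy: "x = Tri a m b" "y = Tri a' m' b'"
    by (cases x; cases y)
  show "\<Psi> (x \<odot> y) = \<Psi> x \<odot> y"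
    by (simp add: xy P q_add \<alpha>(1) \<beta>(1) q_am(1) q_mb(2))
  show "\<Psi> (x \<odot> y) = x \<odot> \<Psi> y"
    by (simp add: xy P q_add \<alpha>(2) \<beta>(2) q_am(2) q_mb(1))
qed

lemma jordan_two_sided_generalized_derivation_imp:
  assumes "jordan_two_sided_generalized_derivation (\<odot>) \<Delta> \<Phi>"
  shows "two_sided_generalized_derivation (\<odot>) \<Delta> \<Phi>"
proof -
  have der: "derivation (\<odot>) \<Delta>"
    using assms jordan_derivation_imp_derivation
    by (simp add: jordan_two_sided_generalized_derivation_def)
  then have \<Delta>: "additive \<Delta>" "\<And>x y. \<Delta> (x \<odot> y) = \<Delta> x \<odot> y + x \<odot> \<Delta> y"
    by (simp_all add: derivation_def)
  have \<Phi>: "additive \<Phi>"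
    and left: "\<And>x. \<Phi> (x \<odot> x) = \<Phi> x \<odot> x + x \<odot> \<Delta> x"
    and right: "\<And>x. \<Phi> (x \<odot> x) = x \<odot> \<Phi> x + \<Delta> x \<odot> x"
    using assms unfolding jordan_two_sided_generalized_derivation_def by blast+
  \<comment> \<open>Subtracting the Leibniz rule of \<open>\<Delta>\<close> leaves identities in \<open>\<Psi>\<close> alone.\<close>
  define \<Psi> where "\<Psi> x = \<Phi> x - \<Delta> x" for x
  have "additive \<Psi>"
    using \<Delta>(1) \<Phi> by (simp add: additive_def \<Psi>_def)
  moreover have "\<Psi> (x \<odot> x) = \<Psi> x \<odot> x" for x
    using left[of x] by (simp add: \<Psi>_def \<Delta>(2) mul_diff_left)
  moreover have "\<Psi> (x \<odot> x) = x \<odot> \<Psi> x" for x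
    using right[of x] by (simp add: \<Psi>_def \<Delta>(2) mul_diff_right)
  ultimately have "\<Psi> (x \<odot> y) = \<Psi> x \<odot> y" "\<Psi> (x \<odot> y) = x \<odot> \<Psi> y" for x y
    by (rule jordan_centralizer_imp_centralizer)+
  then have "\<Phi> (x \<odot> y) = \<Phi> x \<odot> y + x \<odot> \<Delta> y" "\<Phi> (x \<odot> y) = x \<odot> \<Phi> y + \<Delta> x \<odot> y" for x y
    by (simp_all add: \<Psi>_def \<Delta>(2) mul_diff_left mul_diff_right diff_eq_eq algebra_simps)
  then show ?thesis
    using der \<Phi> by (simp add: two_sided_generalized_derivation_def)
qed

end

section \<open>Jordan two-sided generalized derivations of triangular rings\<close>

theorem corollary2p4:
  fixes lact :: "'a::ring \<Rightarrow> 'm::ab_group_add \<Rightarrow> 'm"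
    and ract :: "'m \<Rightarrow> 'b::ring \<Rightarrow> 'm"
    and \<Phi> \<Delta> :: "('a, 'm, 'b) tri \<Rightarrow> ('a, 'm, 'b) tri"
  assumes "two_torsion_free TYPE('a)" and "two_torsion_free TYPE('b)"
    and "semiprime_ring TYPE('a) \<or> condition_P TYPE('a)"
    and "semiprime_ring TYPE('b) \<or> condition_P TYPE('b)"
    and "two_torsion_free TYPE('m)"
    and "faithful_bimodule lact ract"
    and "{m. \<forall>a. lact a m = 0} = {0}"
    and "{m. \<forall>b. ract m b = 0} = {0}"
    and "jordan_derivation (tri_mult lact ract) \<Delta>"
    and "jordan_two_sided_generalized_derivation (tri_mult lact ract) \<Delta> \<Phi>"
  shows "derivation (tri_mult lact ract) \<Delta> \<and>
    two_sided_generalized_derivation (tri_mult lact ract) \<Delta> \<Phi>"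
proof -
  interpret faithful_bimodule lact ract by fact
  interpret admissible_bimodule lact ract
    using assms(1-4,7,8) by unfold_locales auto
  show ?thesis
    using jordan_derivation_imp_derivation[OF assms(9)]
      jordan_two_sided_generalized_derivation_imp[OF assms(10)] by blast
qed

end
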